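(* Let $\Sigma=(\mathcal A,\mathcal A_1,\mathcal G,E,X,U,h)$ be a dt-SNPS-td with input set $U=\{u\in\mathbb R^m\mid b_j^\top u\le1,\ j=1,\dots,J\}$, $b_j\in\mathbb R^m$. Let the state set $X$, initial set $X_a\subset X$ and unsafe set $X_b\subset X$ be given by vectors of polynomial inequalities $X=\{x\in\mathbb R^n\mid\mathcal J(x)\ge0\}$, $X_a=\{x\in\mathbb R^n\mid\mathcal J_a(x)\ge0\}$, $X_b=\{x\in\mathbb R^n\mid\mathcal J_b(x)\ge0\}$. Suppose there exist matrices $P\succ0$, $P_1\succeq0$, a symmetric matrix $\mathcal S$ (all in $\mathbb R^{n\times n}$), polynomial matrices $\mathcal F=F(x,x_h),\mathcal F_1=F_1(x,x_h)\in\mathbb R^{m\times n}$, constants $\alpha,\gamma_a,\gamma_b\in\mathbb R^+$ with $\gamma_b>\gamma_a$, and vectors of SOS polynomials $\hat{\mathcal Y}_j(x,x_h)$, $\hat{\mathcal Y}_{h_j}(x,x_h)$ ($j=1,\dots,J$), $\mathcal Y(x,x_h)$, $\mathcal Y_h(x,x_h)$, $\mathcal Y_a(x)$, $\bar{\mathcal Y}_a(\bar x)$, $\mathcal Y_b(x)$ of appropriate dimensions, such that $P\preceq\frac1\alpha\mathbf I_n$, $\mathcal S\preceq\alpha\mathbf I_n$, and the following expressions are all SOS polynomials (SOS polynomial matrix for the third): $$-x^\top Px-h\,\bar x^\top P_1\bar x-\mathcal Y_a^\top(x)\mathcal J_a(x)-\bar{\mathcal Y}_a^\top(\bar x)\mathcal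 J_a(\bar x)+\gamma_a,$$ $$x^\top Px-\mathcal Y_b^\top(x)\mathcal J_b(x)-\gamma_b,$$ $$\begin{bmatrix}P-P_1&\mathbf 0&(\mathcal A+\mathcal G\mathcal F)^\top\\ \star&P_1&(\mathcal A_1+\mathcal G\mathcal F_1)^\top\\ \star&\star&\mathcal S\end{bmatrix}-\big(\mathcal Y(x,x_h)^\top\mathcal J(x)+\mathcal Y_h(x,x_h)^\top\mathcal J(x_h)\big)\mathbf I_{3n},$$ $$1-b_j^\top(\mathcal Fx+\mathcal F_1x_h)-\hat{\mathcal Y}_j(x,x_h)^\top\mathcal J(x)-\hat{\mathcal Y}_{h_j}(x,x_h)^\top\mathcal J(x_h),\quad j=1,\dots,J.$$ Then $\mathcal B(\mathbf x)=x^\top Px+\sum_{i=1}^hx_i^\top P_1x_i$ is a K-QCBC for $\Sigma$ and $u=\mathcal Fx+\mathcal F_1x_h$ is its safety controller; that is, with $\eta=\mathrm{Tr}(E^\top PE)$: (i) $\mathcal B(\mathbf x)\le\gamma_a$ for all $\mathbf x\in X_a^{h+1}$; (ii) $\mathcal B(\mathbf x)\ge\gamma_b$ for all $\mathbf x\in X_b\times(X\setminus X_b)^h$; (iii) for all $\mathbf x\in X^{h+1}$, the input $u=\mathcal Fx+\mathcal F_1x_h$ lies in $U$ and $\mathbb E[\mathcal B(\mathbf x_{k+1})\mid\mathbf x_k=\mathbf x,u_k=u]-\mathcal B(\mathbf x)\le\eta$.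
   Context: $\mathbb R^+$ denotes the positive reals. $P\succ0$ ($\succeq0$) means symmetric positive definite (semidefinite); $\star$ denotes the transposed entry in the symmetric position; $\mathbf I_n$ is the identity, $\mathbf 0$ a zero block; vector inequalities are componentwise. SOS means sum of squares of polynomials; a symmetric polynomial matrix $M(z)$ is SOS if $M(z)=H(z)^\top H(z)$ for some polynomial matrix $H$. A discrete-time stochastic nonlinear polynomial system with time-invariant delay (dt-SNPS-td) $\Sigma=(\mathcal A,\mathcal A_1,\mathcal G,E,X,U,h)$ is $$x_{k+1}=A(x_k,x_{k-h})x_k+A_1(x_k,x_{k-h})x_{k-h}+G(x_k,x_{k-h})u_k+Ew_k,\quad k\in\mathbb N,$$ where $h\in\mathbb N^+$ is the delay; $x_k,x_{k-h}\in X\subseteq\mathbb R^n$; $u_k\in U$; $(w_k)$ are i.i.d. with standard normal distribution $\mathcal N(\mathbf 0,\mathbf I_n)$; $A(\cdot,\cdot),A_1(\cdot,\cdot)\in\mathbb R^{n\times n}$ and $G(\cdot,\cdot)\in\mathbb R^{n\times m}$ are polynomial matrices and $E\in\mathbb R^{n\times n}$ is constant. Abbreviations: $\mathcal A=A(x,x_h)$, $\mathcal A_1=A_1(x,x_h)$, $\mathcal G=G(x,x_h)$. The state history at time $k$ is $\mathbf x_k=(x_k,x_{k-1},\dots,x_{k-h})\in X^{h+1}$, with successor $\mathbf x_{k+1}=(x_{k+1},x_k,\dots,x_{k-h+1})$; a generic history is written $\mathbf x=(x,x_1,\dots,x_h)$, with $x$ the current and $x_h$ the $h$-step delayed state. The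 conditional expectation is over $w_k\sim\mathcal N(\mathbf 0,\mathbf I_n)$, with $x_{k+1}$ given by the dynamics and $\mathcal B$ evaluated through its formula. A Krasovskii quadratic control barrier certificate (K-QCBC) is a nonnegative function of the quadratic form $\mathcal B(\mathbf x)=x^\top Px+\sum_{i=1}^hx_i^\top P_1x_i$ satisfying, for some constants $\eta,\gamma_a,\gamma_b\in\mathbb R^+$ with $\gamma_b>\gamma_a$: $\mathcal B(\mathbf x)\le\gamma_a$ for all $\mathbf x\in X_a^{h+1}$; $\mathcal B(\mathbf x)\ge\gamma_b$ for all $\mathbf x\in X_b\times(X\setminus X_b)^h$; and, for each $\mathbf x\in X^{h+1}$, $\mathbb E[\mathcal B(\mathbf x_{k+1})\mid\mathbf x_k=\mathbf x,u_k=u]-\mathcal B(\mathbf x)\le\eta$ with some input $u\in U$. A safety controller is a feedback with values in $U$ realizing this last inequality. *)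

theory Defs
  imports "HOL-Analysis.Analysis" "HOL-Probability.Probability"
begin

section \<open>Definite matrices and block matrices\<close>

definition pos_semidef :: "real^'n^'n \<Rightarrow> bool" where
  "pos_semidef M \<longleftrightarrow> transpose M = M \<and> (\<forall>v. 0 \<le> v \<bullet> (M *v v))"

definition pos_def :: "real^'n^'n \<Rightarrow> bool" where
  "pos_def M \<longleftrightarrow> transpose M = M \<and> (\<forall>v. v \<noteq> 0 \<longrightarrow> 0 < v \<bullet> (M *v v))"

definition loewner_le :: "real^'n^'n \<Rightarrow> real^'n^'n \<Rightarrow> bool" (infix "\<preceq>\<^sub>L" 50) where
  "M \<preceq>\<^sub>L N \<longleftrightarrow> pos_semidef (N - M)"

text \<open>The block matrix with rows \<open>M11 M12 M13\<close>, \<open>M21 M22 M23\<close>, \<open>M31 M32 M33\<close>.  Its index type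
  \<open>'n + 'n + 'n\<close> has \<open>3 n\<close> elements; the summands number the blocks.\<close>

definition block3 ::
  "real^'n^'n \<Rightarrow> real^'n^'n \<Rightarrow> real^'n^'n \<Rightarrow>
   real^'n^'n \<Rightarrow> real^'n^'n \<Rightarrow> real^'n^'n \<Rightarrow>
   real^'n^'n \<Rightarrow> real^'n^'n \<Rightarrow> real^'n^'n \<Rightarrow> real^('n + 'n + 'n)^('n + 'n + 'n)" where
  "block3 M11 M12 M13 M21 M22 M23 M31 M32 M33 = (\<chi> i j.
     (case i of
        Inl a \<Rightarrow>
          (case j of Inl b \<Rightarrow> M11 $ a $ b | Inr (Inl b) \<Rightarrow> M12 $ a $ b | Inr (Inr b) \<Rightarrow> M13 $ a $ b)
      | Inr (Inl a) \<Rightarrow>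
          (case j of Inl b \<Rightarrow> M21 $ a $ b | Inr (Inl b) \<Rightarrow> M22 $ a $ b | Inr (Inr b) \<Rightarrow> M23 $ a $ b)
      | Inr (Inr a) \<Rightarrow>
          (case j of Inl b \<Rightarrow> M31 $ a $ b | Inr (Inl b) \<Rightarrow> M32 $ a $ b | Inr (Inr b) \<Rightarrow> M33 $ a $ b)))"


section \<open>Sums of squares\<close>

text \<open>Polynomials in \<open>z\<close> are represented by the functions they induce
  (\<^const>\<open>real_polynomial_function\<close>, and \<^const>\<open>polynomial_function\<close> for vectors and matrices of
  polynomials); over the reals this loses nothing.  A polynomial in \<open>(x, y)\<close> is a polynomial
  function on a product space.\<close>

definition sos :: "('a::real_normed_vector \<Rightarrow> real) \<Rightarrow> bool" where
  "sos f \<longleftrightarrow>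
     (\<exists>ps. (\<forall>p \<in> set ps. real_polynomial_function p) \<and> (\<forall>z. f z = (\<Sum>p\<leftarrow>ps. (p z)\<^sup>2)))"

definition sos_vector :: "('a::real_normed_vector \<Rightarrow> real^'p) \<Rightarrow> bool" where
  "sos_vector f \<longleftrightarrow> (\<forall>i. sos (\<lambda>z. f z $ i))"

text \<open>\<open>M(z) = H(z)\<^sup>T H(z)\<close> for a polynomial matrix \<open>H\<close> with any number of rows.
  The list \<open>hs\<close> consists of the rows of \<open>H\<close>.\<close>

definition sos_matrix :: "('a::real_normed_vector \<Rightarrow> real^'k^'k) \<Rightarrow> bool" where
  "sos_matrix M \<longleftrightarrow>
     (\<exists>hs :: ('a \<Rightarrow> real^'k) list. (\<forall>r \<in> set hs. polynomial_function r) \<and>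
        (\<forall>z i j. M z $ i $ j = (\<Sum>r\<leftarrow>hs. r z $ i * r z $ j)))"


section \<open>Stochastic polynomial systems with time-invariant delay\<close>

record ('n, 'm) snps_td =
  mat_A :: "(real^'n) \<times> (real^'n) \<Rightarrow> real^'n^'n"
  mat_A1 :: "(real^'n) \<times> (real^'n) \<Rightarrow> real^'n^'n"
  mat_G :: "(real^'n) \<times> (real^'n) \<Rightarrow> real^'m^'n"
  mat_E :: "real^'n^'n"
  states :: "(real^'n) set"
  inputs :: "(real^'m) set"
  delay :: nat

definition dt_snps_td :: "('n::finite, 'm::finite) snps_td \<Rightarrow> bool" where
  "dt_snps_td \<Sigma> \<longleftrightarrow>
     polynomial_function (mat_A \<Sigma>) \<and> polynomial_function (mat_A1 \<Sigma>) \<and>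
     polynomial_function (mat_G \<Sigma>) \<and> 1 \<le> delay \<Sigma>"

text \<open>A history \<open>(x, x\<^sub>1, \<dots>, x\<^sub>h)\<close> is a function \<open>xs :: nat \<Rightarrow> real^'n\<close> with
  \<open>xs 0 = x\<close> and \<open>xs i = x\<^sub>i\<close>; its values above the delay \<open>h\<close> are never read.\<close>

definition histories :: "nat \<Rightarrow> (real^'n) set \<Rightarrow> (nat \<Rightarrow> real^'n) set" where
  "histories h S = {xs. \<forall>i\<le>h. xs i \<in> S}"

definition next_state ::
  "('n::finite, 'm::finite) snps_td \<Rightarrow> (nat \<Rightarrow> real^'n) \<Rightarrow> real^'m \<Rightarrow> real^'n \<Rightarrow> real^'n" where
  "next_state \<Sigma> xs u w =
     (let x = xs 0; xh = xs (delay \<Sigma>) in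
      mat_A \<Sigma> (x, xh) *v x + mat_A1 \<Sigma> (x, xh) *v xh + mat_G \<Sigma> (x, xh) *v u + mat_E \<Sigma> *v w)"

definition successor :: "(nat \<Rightarrow> real^'n) \<Rightarrow> real^'n \<Rightarrow> nat \<Rightarrow> real^'n" where
  "successor xs x' i = (case i of 0 \<Rightarrow> x' | Suc k \<Rightarrow> xs k)"

text \<open>The distribution \<open>N(0, I)\<close> on \<open>real^'n\<close>.\<close>

definition std_normal_vec :: "(real^'n) measure" where
  "std_normal_vec = density lborel (\<lambda>w. ennreal (\<Prod>i\<in>UNIV. std_normal_density (w $ i)))"

text \<open>\<open>E[B(x\<^sub>k\<^sub>+\<^sub>1) | x\<^sub>k = xs, u\<^sub>k = u] - B(xs) \<le> \<eta>\<close>.  Integrability says that the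
  expectation is finite; without it the Bochner integral would be 0 by convention.\<close>

definition drift_le ::
  "('n::finite, 'm::finite) snps_td \<Rightarrow> ((nat \<Rightarrow> real^'n) \<Rightarrow> real) \<Rightarrow> (nat \<Rightarrow> real^'n) \<Rightarrow> real^'m \<Rightarrow>
   real \<Rightarrow> bool" where
  "drift_le \<Sigma> B xs u \<eta> \<longleftrightarrow>
     integrable std_normal_vec (\<lambda>w. B (successor xs (next_state \<Sigma> xs u w))) \<and>
     (\<integral>w. B (successor xs (next_state \<Sigma> xs u w)) \<partial>std_normal_vec) - B xs \<le> \<eta>"


section \<open>Krasovskii quadratic control barrier certificates\<close>

definition krasovskii :: "nat \<Rightarrow> real^'n^'n \<Rightarrow> real^'n^'n \<Rightarrow> (nat \<Rightarrow> real^'n) \<Rightarrow> real" where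
  "krasovskii h P P1 xs = xs 0 \<bullet> (P *v xs 0) + (\<Sum>i=1..h. xs i \<bullet> (P1 *v xs i))"

definition K_QCBC ::
  "('n::finite, 'm::finite) snps_td \<Rightarrow> (real^'n) set \<Rightarrow> (real^'n) set \<Rightarrow>
   ((nat \<Rightarrow> real^'n) \<Rightarrow> real) \<Rightarrow> bool" where
  "K_QCBC \<Sigma> Xa Xb B \<longleftrightarrow>
     (\<exists>P P1. B = krasovskii (delay \<Sigma>) P P1) \<and> (\<forall>xs. 0 \<le> B xs) \<and>
     (\<exists>\<eta> \<gamma>a \<gamma>b. 0 < \<eta> \<and> 0 < \<gamma>a \<and> 0 < \<gamma>b \<and> \<gamma>a < \<gamma>b \<and>
        (\<forall>xs \<in> histories (delay \<Sigma>) Xa. B xs \<le> \<gamma>a) \<and>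
        (\<forall>xs. xs 0 \<in> Xb \<and> (\<forall>i\<in>{1..delay \<Sigma>}. xs i \<in> states \<Sigma> - Xb) \<longrightarrow> \<gamma>b \<le> B xs) \<and>
        (\<forall>xs \<in> histories (delay \<Sigma>) (states \<Sigma>). \<exists>u \<in> inputs \<Sigma>. drift_le \<Sigma> B xs u \<eta>))"

definition safety_controller ::
  "('n::finite, 'm::finite) snps_td \<Rightarrow> ((nat \<Rightarrow> real^'n) \<Rightarrow> real) \<Rightarrow> real \<Rightarrow>
   ((nat \<Rightarrow> real^'n) \<Rightarrow> real^'m) \<Rightarrow> bool" where
  "safety_controller \<Sigma> B \<eta> \<kappa> \<longleftrightarrow>
     (\<forall>xs \<in> histories (delay \<Sigma>) (states \<Sigma>). \<kappa> xs \<in> inputs \<Sigma> \<and> drift_le \<Sigma> B xs (\<kappa> xs) \<eta>)"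

end

theory Submission
  imports Defs
begin

text \<open>The sum-of-squares hypotheses enter only through nonnegativity.  Averaging the first
  inequality at \<open>(x, x\<^sub>i)\<close> over \<open>i\<close> bounds the certificate on the initial set.  For the drift put
  \<open>f = M x + M\<^sub>1 x\<^sub>h\<close>, the closed-loop mean of the next state.  The quadratic form of the block matrix
  at \<open>(x, x\<^sub>h, - f / \<alpha>)\<close>, together with \<open>S \<preceq> \<alpha> I\<close>, gives
  \<open>x\<^sup>T (P - P\<^sub>1) x + x\<^sub>h\<^sup>T P\<^sub>1 x\<^sub>h \<ge> |f|\<^sup>2 / \<alpha> \<ge> f\<^sup>T P f\<close>, the last step by \<open>P \<preceq> I / \<alpha>\<close>;
  the noise contributes exactly \<open>Tr (E\<^sup>T P E)\<close>.\<close>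

section \<open>Nonnegativity of sums of squares\<close>

lemma sos_nonneg: "sos f \<Longrightarrow> 0 \<le> f z"
  by (auto simp: sos_def intro!: sum_list_nonneg)

lemma sos_vector_inner_nonneg:
  assumes "sos_vector f" "0 \<le> v"
  shows "0 \<le> f z \<bullet> v"
  using assms
  by (auto simp: sos_vector_def inner_vec_def less_eq_vec_def intro!: sum_nonneg mult_nonneg_nonneg
      intro: sos_nonneg[of "\<lambda>z. f z $ i" for i])

lemma inner_matrix_vector_mult:
  fixes M :: "real^'k^'l"
  shows "v \<bullet> (M *v w) = (\<Sum>i\<in>UNIV. \<Sum>j\<in>UNIV. M $ i $ j * (v $ i * w $ j))"
  by (simp add: inner_vec_def matrix_vector_mult_def sum_distrib_left algebra_simps)

text \<open>If \<open>M z\<close> factors as H^T H, the form at \<open>v\<close> is |H v|^2: each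
  row \<open>r\<close> of H contributes the entry \<open>r z \<bullet> v\<close> of H v, and the
  double sum over \<open>i\<close> and \<open>j\<close> is the square of that entry.\<close>

lemma sos_matrix_quadratic_nonneg:
  assumes "sos_matrix M"
  shows "0 \<le> v \<bullet> (M z *v v)"
proof -
  obtain hs where hs: "\<And>i j. M z $ i $ j = (\<Sum>r\<leftarrow>hs. r z $ i * r z $ j)"
    using assms by (auto simp: sos_matrix_def)
  have "v \<bullet> (M z *v v) = (\<Sum>i\<in>UNIV. \<Sum>j\<in>UNIV. (\<Sum>r\<leftarrow>hs. r z $ i * r z $ j) * (v $ i * v $ j))"
    by (simp add: inner_matrix_vector_mult hs)
  also have "\<dots> = (\<Sum>r\<leftarrow>hs. (r z \<bullet> v)\<^sup>2)"
  proof (induction hs)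
    case (Cons r hs)
    have "(r z \<bullet> v)\<^sup>2 = (\<Sum>i\<in>UNIV. \<Sum>j\<in>UNIV. r z $ i * r z $ j * (v $ i * v $ j))"
      by (simp add: power2_eq_square inner_vec_def sum_product mult_ac)
    with Cons show ?case
      by (simp add: distrib_right sum.distrib)
  qed simp
  also have "0 \<le> \<dots>"
    by (auto intro!: sum_list_nonneg)
  finally show ?thesis .
qed

section \<open>Quadratic forms\<close>

text \<open>The stacked column (x, y, z) with the index convention of \<open>block3\<close>, so that
  a form in 3n variables splits into nine forms in n variables.\<close>

definition vec3 :: "real^'n \<Rightarrow> real^'n \<Rightarrow> real^'n \<Rightarrow> real^('n + 'n + 'n)" where
  "vec3 x y z = (\<chi> i. case i of Inl a \<Rightarrow> x $ a | Inr (Inl a) \<Rightarrow> y $ a | Inr (Inr a) \<Rightarrow> z $ a)"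

lemma sum_UNIV_Plus:
  fixes f :: "'a::finite + 'b::finite \<Rightarrow> real"
  shows "sum f UNIV = (\<Sum>a\<in>UNIV. f (Inl a)) + (\<Sum>b\<in>UNIV. f (Inr b))"
  by (simp add: UNIV_Plus_UNIV[symmetric] sum.Plus del: UNIV_Plus_UNIV)

lemma block3_quadratic_form:
  fixes x y z :: "real^'n::finite"
  shows "vec3 x y z \<bullet> (block3 M11 M12 M13 M21 M22 M23 M31 M32 M33 *v vec3 x y z) =
    x \<bullet> (M11 *v x) + x \<bullet> (M12 *v y) + x \<bullet> (M13 *v z) +
    y \<bullet> (M21 *v x) + y \<bullet> (M22 *v y) + y \<bullet> (M23 *v z) +
    z \<bullet> (M31 *v x) + z \<bullet> (M32 *v y) + z \<bullet> (M33 *v z)"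
  by (simp add: inner_matrix_vector_mult sum_UNIV_Plus block3_def vec3_def sum.distrib)

text \<open>The adjoint identity, with \<open>y v* M\<close> in the role of
  \<open>transpose M *v y\<close>. It merges each off-diagonal block with its transposed
  partner.\<close>

lemma inner_vector_matrix_mult: "x \<bullet> (y v* M) = y \<bullet> (M *v (x::real^'n))"
  by (metis dot_lmul_matrix inner_commute)

lemma loewner_le_scaled_mat1D:
  assumes "M \<preceq>\<^sub>L c *\<^sub>R mat 1"
  shows "v \<bullet> (M *v v) \<le> c * (v \<bullet> v)"
proof -
  have "0 \<le> v \<bullet> ((c *\<^sub>R mat 1 - M) *v v)"
    using assms by (simp add: loewner_le_def pos_semidef_def)
  then show ?thesis
    by (simp add: matrix_vector_mult_diff_rdistrib scaleR_matrix_vector_assoc[symmetric] inner_diff_right)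
qed

lemma pos_def_imp_pos_semidef: "pos_def M \<Longrightarrow> pos_semidef M"
  unfolding pos_def_def pos_semidef_def by (metis inner_zero_left order.refl less_imp_le)

text \<open>A Schur complement estimate with \<open>S\<close> replaced by its upper bound, \<alpha>
  times the identity. The inverse of that bound is explicit and dominates \<open>P\<close>.\<close>

lemma block3_schur_bound:
  fixes P P1 S M M1 :: "real^'n::finite^'n"
  assumes "0 < \<alpha>" and P: "P \<preceq>\<^sub>L (1 / \<alpha>) *\<^sub>R mat 1" and S: "S \<preceq>\<^sub>L \<alpha> *\<^sub>R mat 1"
    and block: "\<And>v. 0 \<le> v \<bullet> (block3 Q 0 (transpose M) 0 Q1 (transpose M1) M M1 S *v v)"
  shows "(M *v x + M1 *v y) \<bullet> (P *v (M *v x + M1 *v y)) \<le> x \<bullet> (Q *v x) + y \<bullet> (Q1 *v y)"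
proof -
  define f where "f = M *v x + M1 *v y"
  \<comment> \<open>The minimiser of
    \<open>2 * (v \<bullet> f) + \<alpha> * (v \<bullet> v)\<close>, with minimum
    \<open>- (f \<bullet> f) / \<alpha>\<close>.\<close>
  define v where "v = - (1 / \<alpha>) *\<^sub>R f"
  have "0 \<le> x \<bullet> (Q *v x) + y \<bullet> (Q1 *v y) + 2 * (v \<bullet> f) + v \<bullet> (S *v v)"
    using block[of "vec3 x y v"]
    by (simp add: block3_quadratic_form inner_vector_matrix_mult f_def inner_add_right)
  also have "v \<bullet> (S *v v) \<le> \<alpha> * (v \<bullet> v)"
    by (rule loewner_le_scaled_mat1D[OF S])
  also have "2 * (v \<bullet> f) = - 2 * (f \<bullet> f) / \<alpha>"
    by (simp add: v_def)
  also have "\<alpha> * (v \<bullet> v) = (f \<bullet> f) / \<alpha>"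
    using \<open>0 < \<alpha>\<close> by (simp add: v_def)
  finally have "(f \<bullet> f) / \<alpha> \<le> x \<bullet> (Q *v x) + y \<bullet> (Q1 *v y)"
    by (simp add: field_simps)
  with loewner_le_scaled_mat1D[OF P, of f] show ?thesis
    by (simp add: f_def)
qed

section \<open>Moments of the standard normal vector\<close>

text \<open>Fubini for a product of one-variable functions. Lebesgue measure on
  \<open>real^'n\<close> is the image of a product measure indexed by basis vectors rather than by
  coordinates, so most of the proof passes between these two index sets.\<close>

lemma has_bochner_integral_lborel_vec_prod:
  fixes g :: "'n::finite \<Rightarrow> real \<Rightarrow> real"
  assumes "\<And>i. has_bochner_integral lborel (g i) (m i)"
  shows "has_bochner_integral lborel (\<lambda>w::real^'n. \<Prod>i\<in>UNIV. g i (w $ i)) (\<Prod>i\<in>UNIV. m i)"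
proof -
  interpret product_sigma_finite "\<lambda>_::real^'n. lborel :: real measure" ..
  let ?ax = "\<lambda>i::'n. axis i (1::real)"
  \<comment> \<open>The family \<open>g\<close> reindexed along the bijection that sends a
    coordinate \<open>i\<close> to the basis vector \<open>axis i 1\<close>.\<close>
  define h where "h b = g (the_inv ?ax b)" for b
  have inj: "inj ?ax"
    by (auto simp: inj_def axis_eq_axis)
  have Basis: "(Basis :: (real^'n) set) = range ?ax"
    by (auto simp: Basis_vec_def)
  have h: "h (?ax i) = g i" for i
    by (simp add: h_def the_inv_f_f[OF inj])
  have int_h: "integrable lborel (h b)" if "b \<in> Basis" for b
    using that assms by (auto simp: Basis h has_bochner_integral_iff)
  let ?T = "\<lambda>f. \<Sum>b\<in>Basis. f b *\<^sub>R (b::real^'n)"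
  have coord: "?T f $ i = f (?ax i)" for f i
  proof -
    have "?T f $ i = ?T f \<bullet> ?ax i"
      by (simp add: inner_axis)
    also have "\<dots> = f (?ax i)"
      by (rule inner_sum_left_Basis) (simp add: Basis)
    finally show ?thesis .
  qed
  have prod_eq: "(\<Prod>i\<in>UNIV. g i (?T f $ i)) = (\<Prod>b\<in>Basis. h b (f b))" for f
    unfolding coord by (simp add: Basis prod.reindex[OF inj] h)
  have T: "?T \<in> (\<Pi>\<^sub>M b\<in>Basis. lborel) \<rightarrow>\<^sub>M borel"
    by measurable
  have [measurable]: "g i \<in> borel_measurable borel" for i
    using assms[of i] by (auto simp: has_bochner_integral_iff)
  have meas: "(\<lambda>w::real^'n. \<Prod>i\<in>UNIV. g i (w $ i)) \<in> borel_measurable borel"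
    by measurable
  have "integrable (\<Pi>\<^sub>M b\<in>Basis. lborel) (\<lambda>f. \<Prod>b\<in>Basis. h b (f b))"
    by (rule product_integrable_prod) (auto intro: int_h)
  then have "integrable lborel (\<lambda>w::real^'n. \<Prod>i\<in>UNIV. g i (w $ i))"
    by (simp add: lborel_eq[where 'a="real^'n"] integrable_distr_eq[OF T meas] prod_eq del: sum_component)
  moreover have "(\<integral>w. (\<Prod>i\<in>UNIV. g i (w $ i)) \<partial>(lborel :: (real^'n) measure)) = (\<Prod>i\<in>UNIV. m i)"
  proof -
    have "(\<integral>w. (\<Prod>i\<in>UNIV. g i (w $ i)) \<partial>(lborel :: (real^'n) measure)) =
        (\<integral>f. (\<Prod>b\<in>Basis. h b (f b)) \<partial>(\<Pi>\<^sub>M b\<in>Basis. lborel))"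
      by (simp add: lborel_eq[where 'a="real^'n"] integral_distr[OF T meas] prod_eq del: sum_component)
    also have "\<dots> = (\<Prod>b\<in>Basis. \<integral>t. h b t \<partial>lborel)"
      by (rule product_integral_prod) (auto intro: int_h)
    also have "\<dots> = (\<Prod>i\<in>UNIV. m i)"
      using assms by (simp add: Basis prod.reindex[OF inj] h has_bochner_integral_iff)
    finally show ?thesis .
  qed
  ultimately show ?thesis
    by (simp add: has_bochner_integral_iff)
qed

text \<open>The normal density is itself a product over coordinates, so it is absorbed factor by
  factor into \<open>g\<close>. This expresses the independence of the coordinates.\<close>

lemma has_bochner_integral_std_normal_vec_prod:
  fixes g :: "'n::finite \<Rightarrow> real \<Rightarrow> real"
  assumes "\<And>i. has_bochner_integral lborel (\<lambda>t. std_normal_density t * g i t) (m i)"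
    and [measurable]: "\<And>i. g i \<in> borel_measurable borel"
  shows "has_bochner_integral std_normal_vec (\<lambda>w::real^'n. \<Prod>i\<in>UNIV. g i (w $ i)) (\<Prod>i\<in>UNIV. m i)"
  unfolding std_normal_vec_def
  using has_bochner_integral_lborel_vec_prod[OF assms(1)]
  by (intro has_bochner_integral_density) (auto simp: prod.distrib intro!: prod_nonneg)

text \<open>Total mass, mean and variance, in the shape of density times factor that the product
  rule expects.\<close>

lemma std_normal_density_moments:
  "has_bochner_integral lborel (\<lambda>t. std_normal_density t * 1) 1"
  "has_bochner_integral lborel (\<lambda>t. std_normal_density t * t) 0"
  "has_bochner_integral lborel (\<lambda>t. std_normal_density t * (t * t)) 1"
  using std_normal_moment_even[of 0] std_normal_moment_odd[of 0] std_normal_moment_even[of 1]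
  by (simp_all add: power2_eq_square)

lemma std_normal_vec_moments:
  fixes i j :: "'n::finite"
  shows "has_bochner_integral std_normal_vec (\<lambda>w::real^'n. 1::real) 1"
    and "has_bochner_integral std_normal_vec (\<lambda>w::real^'n. w $ i) 0"
    and "has_bochner_integral std_normal_vec (\<lambda>w::real^'n. w $ i * w $ j) (if i = j then 1 else 0)"
proof -
  show "has_bochner_integral std_normal_vec (\<lambda>w::real^'n. 1::real) 1"
    using has_bochner_integral_std_normal_vec_prod[of "\<lambda>_ _. 1" "\<lambda>_::'n. 1"] std_normal_density_moments
    by simp
  \<comment> \<open>The coordinate \<open>w $ i\<close> is written as a product over all
    coordinates, with factor 1 at every index other than \<open>i\<close>. The one factor of mean 0
    makes the integral vanish.\<close>
  have "has_bochner_integral std_normal_vec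
      (\<lambda>w::real^'n. \<Prod>k\<in>UNIV. if k = i then w $ k else 1) (\<Prod>k\<in>UNIV. if k = i then 0 else 1)"
    using std_normal_density_moments
    by (intro has_bochner_integral_std_normal_vec_prod) auto
  then show "has_bochner_integral std_normal_vec (\<lambda>w::real^'n. w $ i) 0"
    by (simp add: prod.delta)
  \<comment> \<open>At index \<open>k\<close> the factor is the square of \<open>w $ k\<close>,
    \<open>w $ k\<close> itself or 1, according as both, one or none of \<open>k = i\<close> and
    \<open>k = j\<close> hold. Its mean is 0 exactly when one of them holds, and such a
    \<open>k\<close> exists if and only if \<open>i\<close> and \<open>j\<close> differ.\<close>
  have "has_bochner_integral std_normal_vec
      (\<lambda>w::real^'n. \<Prod>k\<in>UNIV. (if k = i then w $ k else 1) * (if k = j then w $ k else 1))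
      (\<Prod>k\<in>UNIV. if (k = i) = (k = j) then 1 else 0)"
    using std_normal_density_moments
    by (intro has_bochner_integral_std_normal_vec_prod) auto
  moreover have "(\<Prod>k\<in>UNIV. if (k = i) = (k = j) then 1 else 0) = (if i = j then 1 else 0 :: real)"
    by (auto intro!: prod_zero)
  ultimately show "has_bochner_integral std_normal_vec (\<lambda>w::real^'n. w $ i * w $ j) (if i = j then 1 else 0)"
    by (simp add: prod.distrib prod.delta)
qed

lemma std_normal_vec_linear:
  "has_bochner_integral std_normal_vec (\<lambda>w::real^'n::finite. a \<bullet> w) 0"
proof -
  have "has_bochner_integral std_normal_vec (\<lambda>w::real^'n. \<Sum>i\<in>UNIV. a $ i * w $ i) (\<Sum>i\<in>UNIV. a $ i * 0)"
    by (intro has_bochner_integral_sum has_bochner_integral_mult_right std_normal_vec_moments)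
  then show ?thesis
    by (simp add: inner_vec_def)
qed

text \<open>The identity covariance leaves only the diagonal of \<open>Q\<close>.\<close>

lemma std_normal_vec_quadratic:
  fixes Q :: "real^'n::finite^'n"
  shows "has_bochner_integral std_normal_vec (\<lambda>w. w \<bullet> (Q *v w)) (trace Q)"
proof -
  have "has_bochner_integral std_normal_vec (\<lambda>w. w \<bullet> (Q *v w))
      (\<Sum>i\<in>UNIV. \<Sum>j\<in>UNIV. Q $ i $ j * (if i = j then 1 else 0))"
    unfolding inner_matrix_vector_mult
    by (intro has_bochner_integral_sum has_bochner_integral_mult_right std_normal_vec_moments)
  then show ?thesis
    by (simp add: trace_def if_distrib[of "\<lambda>x. _ * x"] cong: if_cong)
qed

text \<open>Expand around the mean \<open>c\<close>: the part linear in the noise integrates to 0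
  and the quadratic part gives the trace.\<close>

lemma std_normal_vec_affine_quadratic:
  fixes P E :: "real^'n::finite^'n"
  shows "has_bochner_integral std_normal_vec (\<lambda>w. (c + E *v w) \<bullet> (P *v (c + E *v w)))
    (c \<bullet> (P *v c) + trace (transpose E ** P ** E))"
proof -
  \<comment> \<open>The two summands stem from the two cross terms, in which \<open>P\<close> acts
    on \<open>c\<close> and on \<open>E *v w\<close> respectively.\<close>
  let ?a = "transpose E *v (P *v c) + transpose E *v (transpose P *v c)"
  let ?Q = "transpose E ** P ** E"
  have "(c + E *v w) \<bullet> (P *v (c + E *v w)) = (c \<bullet> (P *v c)) * 1 + ?a \<bullet> w + w \<bullet> (?Q *v w)" for w
    by (simp add: matrix_vector_right_distrib inner_add_left inner_add_right inner_vector_matrix_mult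
        inner_commute[of _ w] inner_commute[of "E *v w" "P *v c"]
        matrix_vector_mul_assoc[symmetric])
      (metis inner_commute inner_vector_matrix_mult)
  moreover have "has_bochner_integral std_normal_vec
      (\<lambda>w. (c \<bullet> (P *v c)) * 1 + ?a \<bullet> w + w \<bullet> (?Q *v w)) ((c \<bullet> (P *v c)) * 1 + 0 + trace ?Q)"
    by (intro has_bochner_integral_add has_bochner_integral_mult_right std_normal_vec_moments
        std_normal_vec_linear std_normal_vec_quadratic)
  ultimately show ?thesis
    by simp
qed

section \<open>The Krasovskii functional\<close>

text \<open>One time step moves the current state into the delayed sum and drops the oldest state.
  The current state thus trades its \<open>P\<close> term for a \<open>P1\<close> term, which is the
  origin of the block \<open>P - P1\<close>.\<close>

lemma krasovskii_successor:
  fixes P P1 :: "real^'n^'n"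
  assumes "1 \<le> h"
  shows "krasovskii h P P1 (successor xs x') =
    x' \<bullet> (P *v x') + (krasovskii h P P1 xs - xs 0 \<bullet> ((P - P1) *v xs 0) - xs h \<bullet> (P1 *v xs h))"
proof -
  have "(\<Sum>i=1..h. g (successor xs x' i)) = g (xs 0) + (\<Sum>i=1..h. g (xs i)) - g (xs h)"
    for g :: "real^'n \<Rightarrow> real"
    by (induction h) (auto simp: successor_def)
  from this[of "\<lambda>x. x \<bullet> (P1 *v x)"] show ?thesis
    by (simp add: krasovskii_def matrix_vector_mult_diff_rdistrib inner_diff_right)
      (simp add: successor_def)
qed

lemma krasovskii_nonneg:
  assumes "pos_semidef P" "pos_semidef P1"
  shows "0 \<le> krasovskii h P P1 xs"
  using assms by (auto simp: krasovskii_def pos_semidef_def intro!: add_nonneg_nonneg sum_nonneg)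

text \<open>Each of the \<open>h\<close> inequalities carries the current term once and a single
  delayed term \<open>h\<close> times, so their sum is \<open>h\<close> times the functional. Hence
  the weight \<open>h\<close> in a condition that sees only two states at once.\<close>

lemma krasovskii_le_average:
  assumes "1 \<le> h"
    and le: "\<And>i. i \<in> {1..h} \<Longrightarrow> xs 0 \<bullet> (P *v xs 0) + real h * (xs i \<bullet> (P1 *v xs i)) \<le> c"
  shows "krasovskii h P P1 xs \<le> c"
proof -
  have "real h * krasovskii h P P1 xs =
      (\<Sum>i=1..h. xs 0 \<bullet> (P *v xs 0) + real h * (xs i \<bullet> (P1 *v xs i)))"
    by (simp add: krasovskii_def distrib_left sum.distrib sum_distrib_left)
  also have "\<dots> \<le> (\<Sum>i=1..h. c)"
    by (intro sum_mono le)
  finally show ?thesis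
    using \<open>1 \<le> h\<close> by simp
qed

text \<open>Here \<open>f\<close> is the mean of the next state, obtained by setting the noise to 0.
  The bound on its quadratic form says that the noise-free step does not increase the functional;
  the noise then adds the trace.\<close>

lemma drift_le_krasovskii:
  fixes \<Sigma> :: "('n::finite, 'm::finite) snps_td"
  assumes "1 \<le> delay \<Sigma>"
    and mean: "next_state \<Sigma> xs u 0 = f"
    and f: "f \<bullet> (P *v f) \<le> xs 0 \<bullet> ((P - P1) *v xs 0) + xs (delay \<Sigma>) \<bullet> (P1 *v xs (delay \<Sigma>))"
  shows "drift_le \<Sigma> (krasovskii (delay \<Sigma>) P P1) xs u (trace (transpose (mat_E \<Sigma>) ** P ** mat_E \<Sigma>))"
proof -
  let ?B = "krasovskii (delay \<Sigma>) P P1" and ?E = "mat_E \<Sigma>"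
  \<comment> \<open>What the new value of the functional retains from the old history; it is
    constant under the expectation.\<close>
  define r where "r = ?B xs - xs 0 \<bullet> ((P - P1) *v xs 0) - xs (delay \<Sigma>) \<bullet> (P1 *v xs (delay \<Sigma>))"
  have next_eq: "next_state \<Sigma> xs u w = f + ?E *v w" for w
    by (simp add: mean[symmetric] next_state_def Let_def)
  have "has_bochner_integral std_normal_vec
      (\<lambda>w. (f + ?E *v w) \<bullet> (P *v (f + ?E *v w)) + r * 1)
      (f \<bullet> (P *v f) + trace (transpose ?E ** P ** ?E) + r * 1)"
    by (intro has_bochner_integral_add has_bochner_integral_mult_right
        std_normal_vec_affine_quadratic std_normal_vec_moments)
  then have "has_bochner_integral std_normal_vec
      (\<lambda>w. ?B (successor xs (next_state \<Sigma> xs u w))) (f \<bullet> (P *v f) + trace (transpose ?E ** P ** ?E) + r)"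
    by (simp add: krasovskii_successor[OF assms(1)] next_eq r_def)
  with f show ?thesis
    by (auto simp: drift_le_def has_bochner_integral_iff r_def)
qed

lemma drift_le_mono: "drift_le \<Sigma> B xs u \<eta> \<Longrightarrow> \<eta> \<le> \<eta>' \<Longrightarrow> drift_le \<Sigma> B xs u \<eta>'"
  by (auto simp: drift_le_def)

section \<open>From the sum-of-squares conditions to the barrier conditions\<close>

theorem lemma3p9:
  fixes \<Sigma> :: "('n::finite, 'm::finite) snps_td"
    and J :: nat and b :: "nat \<Rightarrow> real^'m"
    and \<J> :: "real^'n \<Rightarrow> real^'p" and \<J>a :: "real^'n \<Rightarrow> real^'q" and \<J>b :: "real^'n \<Rightarrow> real^'r"
    and Xa Xb :: "(real^'n) set"
    and P P1 S :: "real^'n^'n"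
    and F F1 :: "(real^'n) \<times> (real^'n) \<Rightarrow> real^'n^'m"
    and \<alpha> \<gamma>a \<gamma>b :: real
    and Yhat Yhat_h :: "nat \<Rightarrow> (real^'n) \<times> (real^'n) \<Rightarrow> real^'p"
    and Y Y_h :: "(real^'n) \<times> (real^'n) \<Rightarrow> real^'p"
    and Ya Ya_bar :: "real^'n \<Rightarrow> real^'q"
    and Yb :: "real^'n \<Rightarrow> real^'r"
  assumes "dt_snps_td \<Sigma>"
    and "inputs \<Sigma> = {u. \<forall>j\<in>{1..J}. b j \<bullet> u \<le> 1}"
    and "polynomial_function \<J>" and "states \<Sigma> = {x. 0 \<le> \<J> x}"
    and "polynomial_function \<J>a" and "Xa = {x. 0 \<le> \<J>a x}" and "Xa \<subseteq> states \<Sigma>"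
    and "polynomial_function \<J>b" and "Xb = {x. 0 \<le> \<J>b x}" and "Xb \<subseteq> states \<Sigma>"
    and "pos_def P" and "pos_semidef P1" and "transpose S = S"
    and "polynomial_function F" and "polynomial_function F1"
    and "0 < \<alpha>" and "0 < \<gamma>a" and "0 < \<gamma>b" and "\<gamma>a < \<gamma>b"
    and "\<And>j. j \<in> {1..J} \<Longrightarrow> sos_vector (Yhat j)"
    and "\<And>j. j \<in> {1..J} \<Longrightarrow> sos_vector (Yhat_h j)"
    and "sos_vector Y" and "sos_vector Y_h"
    and "sos_vector Ya" and "sos_vector Ya_bar" and "sos_vector Yb"
    and "P \<preceq>\<^sub>L (1 / \<alpha>) *\<^sub>R mat 1" and "S \<preceq>\<^sub>L \<alpha> *\<^sub>R mat 1"
    and "sos (\<lambda>(x, y). - (x \<bullet> (P *v x)) - real (delay \<Sigma>) * (y \<bullet> (P1 *v y))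
              - Ya x \<bullet> \<J>a x - Ya_bar y \<bullet> \<J>a y + \<gamma>a)"
    and "sos (\<lambda>x. x \<bullet> (P *v x) - Yb x \<bullet> \<J>b x - \<gamma>b)"
    and "sos_matrix (\<lambda>(x, xh).
           let M = mat_A \<Sigma> (x, xh) + mat_G \<Sigma> (x, xh) ** F (x, xh);
               M1 = mat_A1 \<Sigma> (x, xh) + mat_G \<Sigma> (x, xh) ** F1 (x, xh)
           in block3 (P - P1)  0   (transpose M)
                     0         P1  (transpose M1)
                     M         M1  S
              - (Y (x, xh) \<bullet> \<J> x + Y_h (x, xh) \<bullet> \<J> xh) *\<^sub>R mat 1)"
    and "\<And>j. j \<in> {1..J} \<Longrightarrow>
           sos (\<lambda>(x, xh). 1 - b j \<bullet> (F (x, xh) *v x + F1 (x, xh) *v xh)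
                - Yhat j (x, xh) \<bullet> \<J> x - Yhat_h j (x, xh) \<bullet> \<J> xh)"
  defines "B \<equiv> krasovskii (delay \<Sigma>) P P1"
    and "\<kappa> \<equiv> \<lambda>xs. F (xs 0, xs (delay \<Sigma>)) *v xs 0 + F1 (xs 0, xs (delay \<Sigma>)) *v xs (delay \<Sigma>)"
  shows "K_QCBC \<Sigma> Xa Xb B
    \<and> (\<forall>xs \<in> histories (delay \<Sigma>) Xa. B xs \<le> \<gamma>a)
    \<and> (\<forall>xs. xs 0 \<in> Xb \<and> (\<forall>i\<in>{1..delay \<Sigma>}. xs i \<in> states \<Sigma> - Xb) \<longrightarrow> \<gamma>b \<le> B xs)
    \<and> safety_controller \<Sigma> B (trace (transpose (mat_E \<Sigma>) ** P ** mat_E \<Sigma>)) \<kappa>"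
proof -
  let ?h = "delay \<Sigma>" and ?\<eta> = "trace (transpose (mat_E \<Sigma>) ** P ** mat_E \<Sigma>)"
  have h: "1 \<le> ?h"
    using assms(1) by (simp add: dt_snps_td_def)
  have initial: "B xs \<le> \<gamma>a" if "xs \<in> histories ?h Xa" for xs
    unfolding B_def
  proof (rule krasovskii_le_average[OF h])
    fix i assume "i \<in> {1..?h}"
    with that have "0 \<le> \<J>a (xs 0)" "0 \<le> \<J>a (xs i)"
      using \<open>Xa = _\<close> by (auto simp: histories_def)
    then have "0 \<le> Ya (xs 0) \<bullet> \<J>a (xs 0)" "0 \<le> Ya_bar (xs i) \<bullet> \<J>a (xs i)"
      using \<open>sos_vector Ya\<close> \<open>sos_vector Ya_bar\<close> by (auto intro: sos_vector_inner_nonneg)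
    moreover note sos_nonneg[OF assms(29), of "(xs 0, xs i)"]
    ultimately show "xs 0 \<bullet> (P *v xs 0) + real ?h * (xs i \<bullet> (P1 *v xs i)) \<le> \<gamma>a"
      by simp
  qed
  \<comment> \<open>The delayed terms can only raise the functional, so the lower bound on the
    current-state form carries over.\<close>
  have unsafe: "\<gamma>b \<le> B xs" if "xs 0 \<in> Xb" for xs
  proof -
    have "0 \<le> Yb (xs 0) \<bullet> \<J>b (xs 0)"
      using that \<open>Xb = _\<close> \<open>sos_vector Yb\<close> by (auto intro: sos_vector_inner_nonneg)
    moreover have "0 \<le> (\<Sum>i=1..?h. xs i \<bullet> (P1 *v xs i))"
      using \<open>pos_semidef P1\<close> by (auto simp: pos_semidef_def intro: sum_nonneg)
    moreover note sos_nonneg[OF assms(30), of "xs 0"]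
    ultimately show ?thesis
      by (simp add: B_def krasovskii_def)
  qed
  have controller: "safety_controller \<Sigma> B ?\<eta> \<kappa>"
    unfolding safety_controller_def
  proof (intro ballI conjI)
    fix xs assume xs: "xs \<in> histories ?h (states \<Sigma>)"
    let ?z = "(xs 0, xs ?h)"
    have J: "0 \<le> \<J> (xs 0)" "0 \<le> \<J> (xs ?h)"
      using xs \<open>states \<Sigma> = _\<close> by (auto simp: histories_def)
    \<comment> \<open>For states satisfying the constraints both multiplier terms are nonnegative,
      so the last sum-of-squares condition leaves the \<open>j\<close>-th input constraint on the
      feedback value.\<close>
    have "b j \<bullet> \<kappa> xs \<le> 1" if "j \<in> {1..J}" for j
    proof -
      have "0 \<le> Yhat j ?z \<bullet> \<J> (xs 0)" "0 \<le> Yhat_h j ?z \<bullet> \<J> (xs ?h)"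
        using J assms(20,21)[OF that] by (auto intro: sos_vector_inner_nonneg)
      with sos_nonneg[OF assms(32)[OF that], of ?z] show ?thesis
        by (simp add: \<kappa>_def)
    qed
    then show "\<kappa> xs \<in> inputs \<Sigma>"
      using assms(2) by simp
    define M where "M = mat_A \<Sigma> ?z + mat_G \<Sigma> ?z ** F ?z"
    define M1 where "M1 = mat_A1 \<Sigma> ?z + mat_G \<Sigma> ?z ** F1 ?z"
    \<comment> \<open>The multiplier of the identity in the matrix condition. It is nonnegative at
      \<open>?z\<close>, so adding \<open>y\<close> times the identity back leaves the block matrix
      with a nonnegative quadratic form there.\<close>
    define y where "y = Y ?z \<bullet> \<J> (xs 0) + Y_h ?z \<bullet> \<J> (xs ?h)"
    have "0 \<le> y"
      unfolding y_def
      using J \<open>sos_vector Y\<close> \<open>sos_vector Y_h\<close>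
      by (intro add_nonneg_nonneg sos_vector_inner_nonneg)
    have "0 \<le> v \<bullet> (block3 (P - P1) 0 (transpose M) 0 P1 (transpose M1) M M1 S *v v)" for v
    proof -
      have "0 \<le> v \<bullet> ((block3 (P - P1) 0 (transpose M) 0 P1 (transpose M1) M M1 S - y *\<^sub>R mat 1) *v v)"
        using sos_matrix_quadratic_nonneg[OF assms(31), of v ?z]
        by (simp add: M_def M1_def y_def Let_def)
      moreover have "0 \<le> y * (v \<bullet> v)"
        using \<open>0 \<le> y\<close> by simp
      ultimately show ?thesis
        by (simp add: matrix_vector_mult_diff_rdistrib scaleR_matrix_vector_assoc[symmetric]
            inner_diff_right)
    qed
    note bound = block3_schur_bound[OF \<open>0 < \<alpha>\<close> assms(27,28) this, of "xs 0" "xs ?h"]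
    \<comment> \<open>Substituting the feedback collects the coefficients of the current and the
      delayed state into the closed-loop matrices \<open>M\<close> and \<open>M1\<close>.\<close>
    have "next_state \<Sigma> xs (\<kappa> xs) 0 = M *v xs 0 + M1 *v xs ?h"
      by (simp add: next_state_def \<kappa>_def M_def M1_def Let_def matrix_vector_mult_add_rdistrib
          matrix_vector_right_distrib matrix_vector_mul_assoc)
    from drift_le_krasovskii[OF h this bound] show "drift_le \<Sigma> B xs (\<kappa> xs) ?\<eta>"
      by (simp add: B_def)
  qed
  have "K_QCBC \<Sigma> Xa Xb B"
    unfolding K_QCBC_def
  proof (intro conjI exI allI ballI impI)
    show "B = krasovskii ?h P P1"
      by (simp add: B_def)
    show "0 \<le> B xs" for xs
      using \<open>pos_def P\<close> \<open>pos_semidef P1\<close>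
      by (simp add: B_def krasovskii_nonneg pos_def_imp_pos_semidef)
    \<comment> \<open>A certificate needs \<open>\<eta> > 0\<close>, but the trace vanishes for \<open>E = 0\<close>.\<close>
    show "0 < \<bar>?\<eta>\<bar> + 1" "0 < \<gamma>a" "0 < \<gamma>b" "\<gamma>a < \<gamma>b"
      using assms by auto
    show "B xs \<le> \<gamma>a" if "xs \<in> histories ?h Xa" for xs
      using that by (rule initial)
    show "\<gamma>b \<le> B xs" if "xs 0 \<in> Xb \<and> (\<forall>i\<in>{1..?h}. xs i \<in> states \<Sigma> - Xb)" for xs
      using that unsafe by blast
    show "\<exists>u\<in>inputs \<Sigma>. drift_le \<Sigma> B xs u (\<bar>?\<eta>\<bar> + 1)" if "xs \<in> histories ?h (states \<Sigma>)" for xs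
    proof
      show "\<kappa> xs \<in> inputs \<Sigma>"
        using that controller by (simp add: safety_controller_def)
      show "drift_le \<Sigma> B xs (\<kappa> xs) (\<bar>?\<eta>\<bar> + 1)"
      proof (rule drift_le_mono)
        show "drift_le \<Sigma> B xs (\<kappa> xs) ?\<eta>"
          using that controller by (simp add: safety_controller_def)
      qed simp
    qed
  qed
  with initial unsafe controller show ?thesis
    by blast
qed

end
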